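(* The upwind Active Flux semi-discretization $\frac{\mathrm d}{\mathrm dt}\mathbf u+D_-\mathbf u=\mathbf 0$ of the linear advection equation $\partial_tu+\partial_xu=0$ with periodic boundary conditions on a uniform grid with $n$ cells, where $$(D_-\mathbf u)_i=\frac{u_{i+1/2}-u_{i-1/2}}{\Delta x},\qquad (D_-\mathbf u)_{i+1/2}=\frac{2u_{i-1/2}-6u_i+4u_{i+1/2}}{\Delta x},$$ is stable.
   Context: Grid: $[x_{\min},x_{\max}]$ is divided into $n$ cells $[x_{i-1/2},x_{i+1/2}]$, $i=0,\dots,n-1$, of equal length $\Delta x=(x_{\max}-x_{\min})/n$. Degrees of freedom are cell averages $u_i$ and point values $u_{i+1/2}$ at cell interfaces. By periodicity $u_{i+n}=u_i$ and $u_{i+n+1/2}=u_{i+1/2}$ (cell indices modulo $n$). They are collected in $\mathbf u=(u_{-1/2},u_0,u_{1/2},u_1,\dots,u_{n-3/2},u_{n-1})^T\in\mathbb R^{2n}$, and $(D_-\mathbf u)_i$, $(D_-\mathbf u)_{i+1/2}$ denote the components of $D_-\mathbf u$ at the positions of $u_i$, $u_{i+1/2}$. Stable (for a linear semi-discretization on a given grid): there is a constant $C$, depending only on the grid and the scheme, such that every solution satisfies $\|\mathbf u(t)\|\le C\|\mathbf u(0)\|$ for all $t\ge0$, where $\|\cdot\|$ is the Euclidean norm. Equivalently, there is a symmetric positive definite matrix $M$ such that $\frac{\mathrm d}{\mathrm dt}\|\mathbf u\|_M^2=\frac{\mathrm d}{\mathrm dt}(\mathbf u^TM\mathbf u)\le0$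 for every solution. *)

theory Defs
  imports Complex_Main "Jordan_Normal_Form.Matrix"
begin

definition euclid_norm :: "real vec \<Rightarrow> real" where
  "euclid_norm v = sqrt (v \<bullet> v)"

text \<open>
  Solutions of $u' + D u = 0$ in $R^N$ for $t \ge 0$; the derivative of the vector-valued
  function is taken componentwise, and is one-sided at $t = 0$.
\<close>

definition is_solution :: "nat \<Rightarrow> (real vec \<Rightarrow> real vec) \<Rightarrow> (real \<Rightarrow> real vec) \<Rightarrow> bool" where
  "is_solution N D u \<longleftrightarrow>
     (\<forall>t\<ge>0. u t \<in> carrier_vec N \<and>
        (\<forall>k<N. ((\<lambda>s. u s $ k) has_real_derivative - (D (u t) $ k)) (at t within {0..})))"

text \<open>To be used for linear maps \<open>D\<close> on $R^N$.\<close>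

definition stable_semidiscretization :: "nat \<Rightarrow> (real vec \<Rightarrow> real vec) \<Rightarrow> bool" where
  "stable_semidiscretization N D \<longleftrightarrow>
     (\<exists>C. \<forall>u. is_solution N D u \<longrightarrow>
        (\<forall>t\<ge>0. euclid_norm (u t) \<le> C * euclid_norm (u 0)))"

definition cell_length :: "real \<Rightarrow> real \<Rightarrow> nat \<Rightarrow> real" where
  "cell_length x_min x_max n = (x_max - x_min) / real n"

text \<open>
  The degrees of freedom are stored in the order
  $(u_{-1/2}, u_0, u_{1/2}, u_1, \ldots, u_{n-3/2}, u_{n-1})$, with entries numbered from 0, so
  $u_i$ is entry $2i+1$ and $u_{i+1/2}$ is entry $2(i+1)$, where $i$ and $i+1$ are reduced modulo
  $n$. \<open>cell_avg n u i\<close> is $u_i$ and \<open>point_val n u i\<close> is $u_{i+1/2}$, for any integer \<open>i\<close>.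
\<close>

definition cell_avg :: "nat \<Rightarrow> real vec \<Rightarrow> int \<Rightarrow> real" where
  "cell_avg n u i = u $ (2 * nat (i mod int n) + 1)"

definition point_val :: "nat \<Rightarrow> real vec \<Rightarrow> int \<Rightarrow> real" where
  "point_val n u i = u $ (2 * nat ((i + 1) mod int n))"

text \<open>
  Entry \<open>k\<close> of $D_- u$: odd \<open>k\<close> is the position of $u_i$ with $i = (k-1)/2$, even \<open>k\<close> that of
  $u_{i+1/2}$ with $i = k/2 - 1$.
\<close>

definition D_minus :: "nat \<Rightarrow> real \<Rightarrow> real vec \<Rightarrow> real vec" where
  "D_minus n dx u = vec (2 * n) (\<lambda>k.
     if odd k then
       (let i = int (k div 2) in (point_val n u i - point_val n u (i - 1)) / dx)
     else
       (let i = int (k div 2) - 1 in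
          (2 * point_val n u (i - 1) - 6 * cell_avg n u i + 4 * point_val n u i) / dx))"

lemma index_bound:
  assumes "n \<ge> 1"
  shows "nat (i mod int n) < n"
  using assms by (simp add: nat_less_iff)

lemma cell_avg_D_minus:
  assumes "n \<ge> 1"
  shows "cell_avg n (D_minus n dx u) i = (point_val n u i - point_val n u (i - 1)) / dx"
  using index_bound[OF assms, of i] assms
  by (simp add: cell_avg_def D_minus_def point_val_def Let_def mod_simps)

lemma point_val_D_minus:
  assumes "n \<ge> 1"
  shows "point_val n (D_minus n dx u) i =
    (2 * point_val n u (i - 1) - 6 * cell_avg n u i + 4 * point_val n u i) / dx"
proof -
  have "((i + 1) mod int n - 1) mod int n = i mod int n"
    by (simp add: mod_simps)
  then show ?thesis
    using index_bound[OF assms, of "i + 1"] assms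
    by (simp add: cell_avg_def D_minus_def point_val_def Let_def)
qed

lemma D_minus_add:
  assumes "n \<ge> 1" "u \<in> carrier_vec (2 * n)" "v \<in> carrier_vec (2 * n)"
  shows "D_minus n dx (u + v) = D_minus n dx u + D_minus n dx v"
proof -
  have *: "cell_avg n (u + v) i = cell_avg n u i + cell_avg n v i"
    "point_val n (u + v) i = point_val n u i + point_val n v i" for i
    using index_bound[OF assms(1), of i] index_bound[OF assms(1), of "i + 1"] assms
    by (simp_all add: cell_avg_def point_val_def)
  show ?thesis
    by (rule eq_vecI) (simp_all add: D_minus_def Let_def * add_divide_distrib diff_divide_distrib)
qed

lemma D_minus_smult:
  assumes "n \<ge> 1" "u \<in> carrier_vec (2 * n)"
  shows "D_minus n dx (c \<cdot>\<^sub>v u) = c \<cdot>\<^sub>v D_minus n dx u"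
proof -
  have *: "cell_avg n (c \<cdot>\<^sub>v u) i = c * cell_avg n u i"
    "point_val n (c \<cdot>\<^sub>v u) i = c * point_val n u i" for i
    using index_bound[OF assms(1), of i] index_bound[OF assms(1), of "i + 1"] assms
    by (simp_all add: cell_avg_def point_val_def)
  show ?thesis
    by (rule eq_vecI) (simp_all add: D_minus_def Let_def * divide_simps algebra_simps)
qed

end

theory Submission
  imports Defs
begin

text \<open>
  Let \<open>v\<close> be the continuous, piecewise quadratic reconstruction of the degrees of freedom: in each
  cell the parabola with the given cell average and the given values at the two interfaces. For
  a solution of the scheme, the residual \<open>v\<^sub>t + v\<^sub>x\<close> is in each cell the parabola with mean zero
  that vanishes at the right interface and equals the jump \<open>J\<close> of \<open>v\<^sub>x\<close> at the left interface.
  Having mean zero, it is orthogonal to $v_{xx}$, which is constant in each cell. The energy to use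
  is therefore not $\int v^2$ but $\int v_x^2$: integration by parts in every cell gives
  $\frac{d}{dt} \int v_x^2 = - \sum J^2 \le 0$, since the remaining interface terms telescope over
  the periodic grid. This is \<open>cell_dissipation_identity\<close> together with
  \<open>sum_periodic_telescope\<close>.

  The energy is only a seminorm: it vanishes on constants. These are controlled by the total mass,
  which the scheme conserves. On a fixed grid, energy and mass together bound every degree of
  freedom (\<open>dof_bound\<close>, a discrete Poincare inequality), and the initial energy and mass are
  bounded by the initial data, so that solutions remain bounded by a multiple of these, with a
  factor that depends on \<open>n\<close> only.
\<close>

section \<open>The energy of the reconstruction\<close>

text \<open>
  With \<open>a\<close> the cell averages and \<open>p i\<close> the value at the interface \<open>i + 1/2\<close>, the derivative of the
  reconstruction (on a cell scaled to length one) is linear with mean \<open>p i - p (i - 1)\<close> and with end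
  values \<open>slope_left\<close> and \<open>slope_right\<close>; \<open>cell_energy\<close> is the integral of its square. The first
  summand comes from the bubble $6 m x (1 - x)$, whose mean \<open>m\<close> is the deviation of the cell
  average from that of the linear interpolant.
\<close>

definition cell_energy :: "(int \<Rightarrow> real) \<Rightarrow> (int \<Rightarrow> real) \<Rightarrow> int \<Rightarrow> real" where
  "cell_energy a p i = 12 * (a i - (p (i - 1) + p i) / 2)\<^sup>2 + (p i - p (i - 1))\<^sup>2"

definition slope_left :: "(int \<Rightarrow> real) \<Rightarrow> (int \<Rightarrow> real) \<Rightarrow> int \<Rightarrow> real" where
  "slope_left a p i = - 4 * p (i - 1) + 6 * a i - 2 * p i"

definition slope_right :: "(int \<Rightarrow> real) \<Rightarrow> (int \<Rightarrow> real) \<Rightarrow> int \<Rightarrow> real" where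
  "slope_right a p i = 2 * p (i - 1) - 6 * a i + 4 * p i"

definition energy :: "nat \<Rightarrow> (int \<Rightarrow> real) \<Rightarrow> (int \<Rightarrow> real) \<Rightarrow> real" where
  "energy n a p = (\<Sum>i<n. cell_energy a p (int i))"

lemma cell_energy_nonneg: "cell_energy a p i \<ge> 0"
  by (simp add: cell_energy_def)

lemma cell_energy_le_energy:
  assumes "i < n"
  shows "cell_energy a p (int i) \<le> energy n a p"
  unfolding energy_def using assms
  by (intro member_le_sum) (auto simp: cell_energy_nonneg)

text \<open>
  The left-hand side is the time derivative of \<open>cell_energy\<close> under the scheme. Apart from the squared
  jump of the slope at the left interface, all that remains is a difference of consecutive
  values of the squared right slope.
\<close>

lemma cell_dissipation_identity:
  "24 * (a i - (p (i - 1) + p i) / 2) *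
      (- ((p i - p (i - 1)) / dx) - (- (slope_right a p (i - 1) / dx) - slope_right a p i / dx) / 2)
    + 2 * (p i - p (i - 1)) * (- (slope_right a p i / dx) + slope_right a p (i - 1) / dx)
   = (- (slope_left a p i - slope_right a p (i - 1))\<^sup>2
       - ((slope_right a p i)\<^sup>2 - (slope_right a p (i - 1))\<^sup>2)) / dx"
proof -
  \<comment> \<open>Only the cell's own slopes are expressed through its degrees of freedom; the slope of the
    neighbouring cell enters as an independent quantity, as does the inverse of \<open>dx\<close>, so that the
    identity becomes one between polynomials.\<close>
  obtain Q where Q: "slope_right a p (i - 1) = Q" by simp
  obtain h where h: "inverse dx = h" by simp
  show ?thesis
    unfolding Q divide_inverse[of _ dx] h
    unfolding slope_right_def slope_left_def
    by (simp add: power2_eq_square field_simps)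
qed

lemma sum_periodic_telescope:
  fixes f :: "int \<Rightarrow> real"
  assumes "f (int n - 1) = f (- 1)"
  shows "(\<Sum>i<n. f (int i) - f (int i - 1)) = 0"
proof -
  have "(\<Sum>i<n. f (int i) - f (int i - 1)) = (\<Sum>i<n. f (int (Suc i) - 1) - f (int i - 1))"
    by simp
  also have "\<dots> = f (int n - 1) - f (int 0 - 1)"
    by (rule sum_lessThan_telescope)
  finally show ?thesis using assms by simp
qed

section \<open>Energy and mass control the degrees of freedom\<close>

text \<open>
  The energy bounds the differences of neighbouring degrees of freedom, hence the distance of all
  of them from \<open>p (- 1)\<close>; the mass then bounds \<open>p (- 1)\<close> itself.
\<close>

lemma dof_bound:
  fixes a p :: "int \<Rightarrow> real" and e m :: real
  assumes n: "n \<ge> 1"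
    and e: "e \<ge> 0" "energy n a p \<le> e\<^sup>2"
    and m: "\<bar>\<Sum>i<n. a (int i)\<bar> \<le> real n * m"
    and j: "j < n"
  shows "\<bar>a (int j)\<bar> \<le> m + 2 * (real n + 1) * e" "\<bar>p (int j - 1)\<bar> \<le> m + 2 * (real n + 1) * e"
proof -
  have local: "\<bar>p (int i) - p (int i - 1)\<bar> \<le> e"
      "\<bar>a (int i) - (p (int i - 1) + p (int i)) / 2\<bar> \<le> e" if "i < n" for i
  proof -
    have *: "cell_energy a p (int i) \<le> e\<^sup>2"
      using cell_energy_le_energy[OF that, of a p] e(2) by linarith
    have "(p (int i) - p (int i - 1))\<^sup>2 \<le> e\<^sup>2"
      using * zero_le_power2[of "a (int i) - (p (int i - 1) + p (int i)) / 2"]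
      unfolding cell_energy_def by linarith
    then show "\<bar>p (int i) - p (int i - 1)\<bar> \<le> e"
      using e(1) by (simp add: abs_le_square_iff[symmetric])
    have "(a (int i) - (p (int i - 1) + p (int i)) / 2)\<^sup>2 \<le> e\<^sup>2"
      using * zero_le_power2[of "p (int i) - p (int i - 1)"]
        zero_le_power2[of "a (int i) - (p (int i - 1) + p (int i)) / 2"]
      unfolding cell_energy_def by linarith
    then show "\<bar>a (int i) - (p (int i - 1) + p (int i)) / 2\<bar> \<le> e"
      using e(1) by (simp add: abs_le_square_iff[symmetric])
  qed
  have path: "\<bar>p (int i - 1) - p (- 1)\<bar> \<le> real i * e" if "i \<le> n" for i
    using that
  proof (induction i)
    case (Suc i)
    then have "\<bar>p (int i - 1) - p (- 1)\<bar> \<le> real i * e" "\<bar>p (int i) - p (int i - 1)\<bar> \<le> e"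
      using local(1)[of i] by auto
    then show ?case by (simp add: algebra_simps)
  qed simp
  have pn: "\<bar>p (int i - 1) - p (- 1)\<bar> \<le> real n * e" if "i \<le> n" for i
    using path[OF that] mult_right_mono[of "real i" "real n" e] that e(1) by simp
  have an: "\<bar>a (int i) - p (- 1)\<bar> \<le> (real n + 1) * e" if "i < n" for i
  proof -
    have "\<bar>p (int i) - p (- 1)\<bar> \<le> real n * e"
      using pn[of "Suc i"] that by simp
    moreover have "\<bar>p (int i - 1) - p (- 1)\<bar> \<le> real n * e"
      using pn[of i] that by simp
    moreover have "(real n + 1) * e = real n * e + e"
      by (simp add: distrib_right)
    ultimately show ?thesis
      using local(2)[OF that] unfolding abs_le_iff add_divide_distrib by linarith
  qed
  have "\<bar>real n * p (- 1) - (\<Sum>i<n. a (int i))\<bar> = \<bar>\<Sum>i<n. a (int i) - p (- 1)\<bar>"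
    by (simp add: sum_subtractf)
  also have "\<dots> \<le> (\<Sum>i<n. \<bar>a (int i) - p (- 1)\<bar>)"
    by (rule sum_abs)
  also have "\<dots> \<le> (\<Sum>i<n. (real n + 1) * e)"
    by (rule sum_mono) (simp add: an)
  finally have "\<bar>real n * p (- 1)\<bar> \<le> real n * (m + (real n + 1) * e)"
    using m by (simp add: algebra_simps)
  then have base: "\<bar>p (- 1)\<bar> \<le> m + (real n + 1) * e"
    using n by (simp add: abs_mult)
  show "\<bar>a (int j)\<bar> \<le> m + 2 * (real n + 1) * e"
    using base an[OF j] by (simp add: algebra_simps)
  show "\<bar>p (int j - 1)\<bar> \<le> m + 2 * (real n + 1) * e"
    using base pn[of j] j e(1) by (simp add: algebra_simps)
qed

lemma energy_le_of_dof_le: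
  assumes "\<And>i. \<bar>a i\<bar> \<le> R" "\<And>i. \<bar>p i\<bar> \<le> R"
  shows "energy n a p \<le> real n * (52 * R\<^sup>2)"
proof -
  have "cell_energy a p i \<le> 52 * R\<^sup>2" for i
  proof -
    have "\<bar>a i - (p (i - 1) + p i) / 2\<bar> \<le> 2 * R"
      using assms(1)[of i] assms(2)[of i] assms(2)[of "i - 1"] unfolding abs_le_iff add_divide_distrib by linarith
    moreover have "\<bar>p i - p (i - 1)\<bar> \<le> 2 * R"
      using assms(2)[of i] assms(2)[of "i - 1"] by linarith
    ultimately have "(a i - (p (i - 1) + p i) / 2)\<^sup>2 \<le> (2 * R)\<^sup>2" "(p i - p (i - 1))\<^sup>2 \<le> (2 * R)\<^sup>2"
      by (simp_all only: abs_le_square_iff[symmetric])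
    then show ?thesis
      unfolding cell_energy_def by (simp add: power_mult_distrib)
  qed
  then have "(\<Sum>i<n. cell_energy a p (int i)) \<le> (\<Sum>i<n. 52 * R\<^sup>2)"
    by (intro sum_mono)
  then show ?thesis
    by (simp add: energy_def)
qed

section \<open>Evolution of energy and mass\<close>

lemma cell_avg_has_derivative:
  assumes "n \<ge> 1" "is_solution (2 * n) (D_minus n dx) u" "t \<ge> 0"
  shows "((\<lambda>s. cell_avg n (u s) i) has_real_derivative
    - ((point_val n (u t) i - point_val n (u t) (i - 1)) / dx)) (at t within {0..})"
proof -
  have "2 * nat (i mod int n) + 1 < 2 * n"
    using index_bound[OF assms(1), of i] by linarith
  then have "((\<lambda>s. cell_avg n (u s) i) has_real_derivative
      - cell_avg n (D_minus n dx (u t)) i) (at t within {0..})"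
    using assms(2,3) unfolding is_solution_def cell_avg_def by blast
  then show ?thesis
    by (simp add: cell_avg_D_minus[OF assms(1)])
qed

lemma point_val_has_derivative:
  assumes "n \<ge> 1" "is_solution (2 * n) (D_minus n dx) u" "t \<ge> 0"
  shows "((\<lambda>s. point_val n (u s) i) has_real_derivative
    - (slope_right (cell_avg n (u t)) (point_val n (u t)) i / dx)) (at t within {0..})"
proof -
  have "2 * nat ((i + 1) mod int n) < 2 * n"
    using index_bound[OF assms(1), of "i + 1"] by linarith
  then have "((\<lambda>s. point_val n (u s) i) has_real_derivative
      - point_val n (D_minus n dx (u t)) i) (at t within {0..})"
    using assms(2,3) unfolding is_solution_def point_val_def by blast
  then show ?thesis
    by (simp add: point_val_D_minus[OF assms(1)] slope_right_def)
qed

lemma point_val_periodic: "point_val n u (int n - 1) = point_val n u (- 1)"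
  by (simp add: point_val_def)

lemma slope_right_periodic:
  "slope_right (cell_avg n u) (point_val n u) (int n - 1)
    = slope_right (cell_avg n u) (point_val n u) (- 1)"
proof -
  have "(int n - 1) mod int n = (- 1) mod int n" "(int n - 1 - 1 + 1) mod int n = (- 1) mod int n"
    by (simp_all add: mod_diff_left_eq[symmetric, of "int n"])
  then show ?thesis
    by (simp add: slope_right_def cell_avg_def point_val_def)
qed

lemma vec_index_dof:
  assumes "k < 2 * n"
  shows "u $ k = (if odd k then cell_avg n u (int (k div 2)) else point_val n u (int (k div 2) - 1))"
  using assms by (auto simp: cell_avg_def point_val_def nat_mod_distrib)

lemma abs_index_le_euclid_norm:
  assumes "v \<in> carrier_vec N" "k < N"
  shows "\<bar>v $ k\<bar> \<le> euclid_norm v"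
proof -
  have "v $ k * v $ k \<le> (\<Sum>i\<in>{0..<N}. v $ i * v $ i)"
    using assms by (intro member_le_sum) auto
  then have "(v $ k)\<^sup>2 \<le> v \<bullet> v"
    using assms(1) by (simp add: scalar_prod_def power2_eq_square)
  then show ?thesis
    unfolding euclid_norm_def by (metis real_sqrt_abs real_sqrt_le_mono)
qed

lemma euclid_norm_le_of_index_le:
  assumes "v \<in> carrier_vec N" "B \<ge> 0" "\<And>k. k < N \<Longrightarrow> \<bar>v $ k\<bar> \<le> B"
  shows "euclid_norm v \<le> sqrt (real N) * B"
proof -
  have "(v $ k)\<^sup>2 \<le> B\<^sup>2" if "k < N" for k
    using assms(2) assms(3)[OF that] by (simp add: abs_le_square_iff[symmetric])
  then have "(\<Sum>k\<in>{0..<N}. (v $ k)\<^sup>2) \<le> (\<Sum>k\<in>{0..<N}. B\<^sup>2)"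
    by (intro sum_mono) simp
  then have "v \<bullet> v \<le> (\<Sum>k\<in>{0..<N}. B\<^sup>2)"
    using assms(1) by (simp add: scalar_prod_def power2_eq_square)
  then have "sqrt (v \<bullet> v) \<le> sqrt (real N * B\<^sup>2)"
    by simp
  then show ?thesis
    using assms(2) by (simp add: euclid_norm_def real_sqrt_mult)
qed

text \<open>
  A function on \<open>{0..}\<close> need only be differentiable from the right at \<open>0\<close>, as solutions are: there
  the mean value theorem asks for continuity alone.
\<close>

lemma nonincreasing_of_derivative_nonpos:
  fixes f f' :: "real \<Rightarrow> real"
  assumes "\<And>s. s \<ge> 0 \<Longrightarrow> (f has_real_derivative f' s) (at s within {0..})"
    and "\<And>s. s \<ge> 0 \<Longrightarrow> f' s \<le> 0" and "t \<ge> 0"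
  shows "f t \<le> f 0"
proof (rule DERIV_nonpos_imp_decreasing_open[OF assms(3)])
  fix s :: real
  assume s: "0 < s" "s < t"
  have "(f has_real_derivative f' s) (at s within {0<..})"
    using assms(1)[of s] s by (auto intro: DERIV_subset)
  moreover have "at s within {0<..} = at s"
    using s by (intro at_within_open) auto
  ultimately have "(f has_real_derivative f' s) (at s)"
    by (simp only:)
  moreover have "f' s \<le> 0"
    using assms(2) s by simp
  ultimately show "\<exists>y. (f has_real_derivative y) (at s) \<and> y \<le> 0"
    by blast
next
  have "continuous_on {0..} f"
    by (rule DERIV_continuous_on) (use assms(1) in auto)
  then show "continuous_on {0..t} f"
    by (rule continuous_on_subset) auto
qed

lemma energy_nonincreasing:
  assumes n: "n \<ge> 1" and dx: "dx > 0" and u: "is_solution (2 * n) (D_minus n dx) u" and t: "t \<ge> 0"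
  shows "energy n (cell_avg n (u t)) (point_val n (u t))
    \<le> energy n (cell_avg n (u 0)) (point_val n (u 0))"
proof -
  define a where "a s = cell_avg n (u s)" for s
  define p where "p s = point_val n (u s)" for s
  define jump where "jump s i = slope_left (a s) (p s) i - slope_right (a s) (p s) (i - 1)" for s i
  define flux where "flux s i = (slope_right (a s) (p s) i)\<^sup>2" for s i
  have squares: "((\<lambda>r. 12 * (f r)\<^sup>2 + (g r)\<^sup>2) has_real_derivative
      24 * f s * f' + 2 * (g s) * g') (at s within {0..})"
    if "(f has_real_derivative f') (at s within {0..})"
      "(g has_real_derivative g') (at s within {0..})" for f g :: "real \<Rightarrow> real" and f' g' s
    by (rule derivative_eq_intros that refl)+ (simp add: algebra_simps)
  have cell: "((\<lambda>r. cell_energy (a r) (p r) i) has_real_derivative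
      (- (jump s i)\<^sup>2 - (flux s i - flux s (i - 1))) / dx) (at s within {0..})" if "s \<ge> 0" for s i
  proof -
    note da = cell_avg_has_derivative[OF n u that, folded a_def p_def]
    note dp = point_val_has_derivative[OF n u that, folded a_def p_def]
    have deviation: "((\<lambda>r. a r i - (p r (i - 1) + p r i) / 2) has_real_derivative
        - ((p s i - p s (i - 1)) / dx) - (- (slope_right (a s) (p s) (i - 1) / dx)
          - slope_right (a s) (p s) i / dx) / 2) (at s within {0..})"
      by (rule DERIV_cong[OF DERIV_diff[OF da DERIV_cdivide[OF DERIV_add[OF dp dp]]]]) simp
    have increment: "((\<lambda>r. p r i - p r (i - 1)) has_real_derivative
        - (slope_right (a s) (p s) i / dx) + slope_right (a s) (p s) (i - 1) / dx)
        (at s within {0..})"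
      by (rule DERIV_cong[OF DERIV_diff[OF dp dp]]) simp
    show ?thesis
      unfolding cell_energy_def jump_def flux_def cell_dissipation_identity[symmetric]
      by (rule squares[OF deviation increment])
  qed
  have total: "(\<Sum>i<n. (- (jump s (int i))\<^sup>2 - (flux s (int i) - flux s (int i - 1))) / dx)
      = - (\<Sum>i<n. (jump s (int i))\<^sup>2) / dx" for s
  proof -
    have "flux s (int n - 1) = flux s (- 1)"
      unfolding flux_def a_def p_def by (simp only: slope_right_periodic)
    from sum_periodic_telescope[OF this] show ?thesis
      by (simp add: sum_divide_distrib[symmetric] sum_subtractf sum_negf)
  qed
  have deriv: "((\<lambda>r. energy n (a r) (p r)) has_real_derivative
      - (\<Sum>i<n. (jump s (int i))\<^sup>2) / dx) (at s within {0..})" if "s \<ge> 0" for s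
    unfolding energy_def total[symmetric] by (intro DERIV_sum cell that)
  have "- (\<Sum>i<n. (jump s (int i))\<^sup>2) / dx \<le> 0" for s
    using dx by (simp add: sum_nonneg)
  from nonincreasing_of_derivative_nonpos[OF deriv this t] show ?thesis
    by (simp only: a_def p_def)
qed

lemma mass_conserved:
  assumes n: "n \<ge> 1" and u: "is_solution (2 * n) (D_minus n dx) u" and t: "t \<ge> 0"
  shows "(\<Sum>i<n. cell_avg n (u t) (int i)) = (\<Sum>i<n. cell_avg n (u 0) (int i))"
proof -
  define S where "S s = (\<Sum>i<n. cell_avg n (u s) (int i))" for s
  have deriv: "(S has_real_derivative 0) (at s within {0..})" if "s \<ge> 0" for s
  proof -
    have "(S has_real_derivative (\<Sum>i<n. - ((point_val n (u s) (int i)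
        - point_val n (u s) (int i - 1)) / dx))) (at s within {0..})"
      unfolding S_def by (intro DERIV_sum cell_avg_has_derivative[OF n u that])
    moreover have "(\<Sum>i<n. - ((point_val n (u s) (int i) - point_val n (u s) (int i - 1)) / dx)) = 0"
      using sum_periodic_telescope[OF point_val_periodic[of n "u s"]]
      by (simp only: sum_negf sum_divide_distrib[symmetric] div_0 minus_zero)
    ultimately show ?thesis by simp
  qed
  have "S t \<le> S 0"
    using nonincreasing_of_derivative_nonpos[of S "\<lambda>_. 0", OF deriv _ t] by simp
  moreover have "- S t \<le> - S 0"
    using nonincreasing_of_derivative_nonpos[of "\<lambda>s. - S s" "\<lambda>_. 0", OF _ _ t]
      DERIV_minus[OF deriv] by simp
  ultimately show ?thesis
    by (simp add: S_def)
qed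

section \<open>Stability\<close>

theorem theorem4p2:
  fixes x_min x_max :: real and n :: nat
  assumes "x_min < x_max" and "n \<ge> 1"
  shows "stable_semidiscretization (2 * n) (D_minus n (cell_length x_min x_max n))"
proof -
  define dx where "dx = cell_length x_min x_max n"
  have dx: "dx > 0"
    using assms by (simp add: dx_def cell_length_def)
  \<comment> \<open>If all initial degrees of freedom are at most \<open>R\<close>, the mean is at most \<open>R\<close> and the energy at
    most \<open>52 n R\<^sup>2\<close> at all times; \<open>K\<close> is what \<open>dof_bound\<close> makes of this.\<close>
  define K where "K = 1 + 2 * (real n + 1) * sqrt (52 * real n)"
  have "euclid_norm (u t) \<le> (sqrt (real (2 * n)) * K) * euclid_norm (u 0)"
    if u: "is_solution (2 * n) (D_minus n dx) u" and t: "t \<ge> 0" for u t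
  proof -
    have carr: "u s \<in> carrier_vec (2 * n)" if "s \<ge> 0" for s
      using u that by (simp add: is_solution_def)
    define R where "R = euclid_norm (u 0)"
    have R: "R \<ge> 0"
      by (simp add: R_def euclid_norm_def scalar_prod_def sum_nonneg)
    have a0: "\<bar>cell_avg n (u 0) i\<bar> \<le> R" and p0: "\<bar>point_val n (u 0) i\<bar> \<le> R" for i
      using index_bound[OF assms(2), of i] index_bound[OF assms(2), of "i + 1"]
      unfolding cell_avg_def point_val_def R_def
      by (auto intro!: abs_index_le_euclid_norm[OF carr])
    define e where "e = sqrt (52 * real n) * R"
    have e: "e \<ge> 0" "energy n (cell_avg n (u t)) (point_val n (u t)) \<le> e\<^sup>2"
      using R energy_nonincreasing[OF assms(2) dx u t]
        energy_le_of_dof_le[of "cell_avg n (u 0)" R "point_val n (u 0)" n, OF a0 p0]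
      by (auto simp: e_def power_mult_distrib)
    have "\<bar>\<Sum>i<n. cell_avg n (u 0) (int i)\<bar> \<le> (\<Sum>i<n. R)"
      by (rule order_trans[OF sum_abs]) (intro sum_mono a0)
    then have m: "\<bar>\<Sum>i<n. cell_avg n (u t) (int i)\<bar> \<le> real n * R"
      by (simp add: mass_conserved[OF assms(2) u t])
    have "\<bar>u t $ k\<bar> \<le> K * R" if "k < 2 * n" for k
    proof -
      have "k div 2 < n" using that by simp
      from dof_bound[OF assms(2) e m this] show ?thesis
        by (simp add: vec_index_dof[OF that] K_def e_def algebra_simps)
    qed
    then have "euclid_norm (u t) \<le> sqrt (real (2 * n)) * (K * R)"
      using R by (intro euclid_norm_le_of_index_le carr t) (auto simp: K_def)
    then show ?thesis
      by (simp add: R_def mult.assoc)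
  qed
  then show ?thesis
    unfolding stable_semidiscretization_def dx_def by blast
qed

end
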